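(* Let $p,q\in\mathbb{C}^*$ with $p\neq q$. Let $A = \mathbb{C}[t,t^{-1}]$, let $\tau,\sigma$ be the $\mathbb{C}$-algebra endomorphisms of $A$ with $\tau(t)=pt$, $\sigma(t)=qt$, and let $D = \dfrac{\tau-\sigma}{p-q}$, a $(\tau,\sigma)$-derivation of $A$. Then the $\mathbb{C}$-linear space $$W_{p,q} = \bigoplus_{n \in \mathbb{Z}} \mathbb{C} \cdot d_n, \qquad d_n = -t^n \cdot D,$$ can be endowed with a structure of Hom-Lie algebra with the bracket defined on generators by $$[d_n,d_m] = q^n p^{-n}\, d_n \circ \tau^{-1} \circ d_m - q^m p^{-m}\, d_m \circ \tau^{-1} \circ d_n ,$$ with commutation relations $$[d_n,d_m] = \left( \frac{[n]}{p^n} - \frac{[m]}{p^m} \right) d_{n+m},$$ and with the twist $\alpha = \mathrm{id} + \overline{\sigma}\,\overline{\tau^{-1}} : W_{p,q} \to W_{p,q}$, given by $$\alpha(d_n) = (1+(q/p)^n)d_n.$$ The bracket satisfies skew-symmetry $[d_m,d_n] = - [d_n,d_m]$ and the Hom-Jacobi identity: for all $n,m,k\in\mathbb{Z}$, $$\circlearrowleft_{n,m,k} \left[\left(1+(q/p)^n\right)d_n,\left[d_m,d_k\right]\right] = 0.$$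
   Context: A $(\tau,\sigma)$-derivation of $A$ is a $\mathbb{C}$-linear map $D : A \to A$ with $D(ab)=D(a)\tau(b)+\sigma(a)D(b)$ for all $a,b\in A$. For $a\in A$, $a\cdot D$ is the map $x\mapsto aD(x)$. For an endomorphism $\beta$ of $A$, $\overline{\beta}(a\cdot D)=\beta(a)\cdot D$. For $n\in\mathbb{Z}$, $[n]=[n]_{p,q} = \dfrac{p^n-q^n}{p-q}$. The symbol $\circlearrowleft_{n,m,k}$ denotes the sum over cyclic permutations of $(n,m,k)$. A Hom-Lie algebra over $\mathbb{C}$ is a triple $(L,[\cdot,\cdot],\alpha)$ with $L$ a vector space, $[\cdot,\cdot]$ a bilinear skew-symmetric bracket on $L$ and $\alpha:L\to L$ a linear map (the twist) such that $[\alpha(x),[y,z]]+[\alpha(y),[z,x]]+[\alpha(z),[x,y]]=0$ for all $x,y,z\in L$. *)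

theory Defs
  imports Complex_Main "HOL-Library.Poly_Mapping" "HOL-Library.Function_Algebras"
begin

text \<open>
  The algebra \<open>\<complex>[t, t\<^sup>-\<^sup>1]\<close> is the group algebra of the integers: finitely supported
  functions from exponents to coefficients, with convolution as multiplication.
\<close>

type_synonym laurent = "int \<Rightarrow>\<^sub>0 complex"

definition tpow :: "int \<Rightarrow> laurent" where
  "tpow n = Poly_Mapping.single n 1"

definition lscale :: "complex \<Rightarrow> laurent \<Rightarrow> laurent" where
  "lscale c a = Poly_Mapping.map ((*) c) a"

lemma lscale_conv_mult: "lscale c a = Poly_Mapping.single 0 c * a"
  by (simp add: lscale_def mult_map_scale_conv_mult)

interpretation laurent: vector_space lscale
proof
  fix a b :: complex and x y :: laurent
  show "lscale a (x + y) = lscale a x + lscale a y"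
    by (simp add: lscale_conv_mult distrib_left)
  show "lscale (a + b) x = lscale a x + lscale b x"
    by (simp add: lscale_conv_mult distrib_right single_add)
  show "lscale a (lscale b x) = lscale (a * b) x"
    by (simp add: lscale_conv_mult mult_single flip: mult.assoc)
  show "lscale 1 x = x"
    by (simp add: lscale_conv_mult)
qed

text \<open>
  Operators on Laurent polynomials form a complex vector space pointwise; the additive
  structure is the one of \<open>Function_Algebras\<close>.
\<close>

definition oscale :: "complex \<Rightarrow> (laurent \<Rightarrow> laurent) \<Rightarrow> laurent \<Rightarrow> laurent" where
  "oscale c F = (\<lambda>x. lscale c (F x))"

interpretation oper: vector_space oscale
  by unfold_locales
    (simp_all add: oscale_def fun_eq_iff laurent.scale_left_distrib laurent.scale_right_distrib)

definition lmul :: "laurent \<Rightarrow> (laurent \<Rightarrow> laurent) \<Rightarrow> laurent \<Rightarrow> laurent" (infixr "\<cdot>\<^sub>A" 75) where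
  "a \<cdot>\<^sub>A F = (\<lambda>x. a * F x)"

definition alg_endo :: "(laurent \<Rightarrow> laurent) \<Rightarrow> bool" where
  "alg_endo \<phi> \<longleftrightarrow> Vector_Spaces.linear lscale lscale \<phi> \<and> \<phi> 1 = 1 \<and> (\<forall>a b. \<phi> (a * b) = \<phi> a * \<phi> b)"

definition twisted_derivation ::
    "(laurent \<Rightarrow> laurent) \<Rightarrow> (laurent \<Rightarrow> laurent) \<Rightarrow> (laurent \<Rightarrow> laurent) \<Rightarrow> bool" where
  "twisted_derivation \<tau> \<sigma> D \<longleftrightarrow> Vector_Spaces.linear lscale lscale D \<and>
     (\<forall>a b. D (a * b) = D a * \<tau> b + \<sigma> a * D b)"

text \<open>
  The map sending \<open>a \<cdot> D\<close> to \<open>\<beta>(a) \<cdot> D\<close>. It is meaningful on operators of the form \<open>a \<cdot> D\<close>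
  when \<open>a\<close> is determined by \<open>a \<cdot> D\<close>, and unspecified elsewhere.
\<close>

definition overline_map ::
    "(laurent \<Rightarrow> laurent) \<Rightarrow> (laurent \<Rightarrow> laurent) \<Rightarrow> (laurent \<Rightarrow> laurent) \<Rightarrow> laurent \<Rightarrow> laurent" where
  "overline_map D \<beta> w = \<beta> (THE a. a \<cdot>\<^sub>A D = w) \<cdot>\<^sub>A D"

definition pq_number :: "complex \<Rightarrow> complex \<Rightarrow> int \<Rightarrow> complex" where
  "pq_number p q n = (p powi n - q powi n) / (p - q)"

text \<open>
  Linear maps and brackets on a subspace \<open>L\<close> of an ambient vector space; only their values
  on \<open>L\<close> matter.
\<close>

definition linear_self_map_on ::
    "(complex \<Rightarrow> 'a \<Rightarrow> 'a) \<Rightarrow> 'a::ab_group_add set \<Rightarrow> ('a \<Rightarrow> 'a) \<Rightarrow> bool" where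
  "linear_self_map_on scale L f \<longleftrightarrow>
     (\<forall>x\<in>L. f x \<in> L) \<and>
     (\<forall>x\<in>L. \<forall>y\<in>L. f (x + y) = f x + f y) \<and>
     (\<forall>c. \<forall>x\<in>L. f (scale c x) = scale c (f x))"

definition bilinear_bracket_on ::
    "(complex \<Rightarrow> 'a \<Rightarrow> 'a) \<Rightarrow> 'a::ab_group_add set \<Rightarrow> ('a \<Rightarrow> 'a \<Rightarrow> 'a) \<Rightarrow> bool" where
  "bilinear_bracket_on scale L br \<longleftrightarrow>
     (\<forall>x\<in>L. linear_self_map_on scale L (\<lambda>y. br x y)) \<and>
     (\<forall>y\<in>L. linear_self_map_on scale L (\<lambda>x. br x y))"

definition hom_lie_algebra ::
    "(complex \<Rightarrow> 'a \<Rightarrow> 'a) \<Rightarrow> 'a::ab_group_add set \<Rightarrow> ('a \<Rightarrow> 'a \<Rightarrow> 'a) \<Rightarrow> ('a \<Rightarrow> 'a) \<Rightarrow> bool" where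
  "hom_lie_algebra scale L br \<alpha> \<longleftrightarrow>
     vector_space scale \<and> module.subspace scale L \<and>
     bilinear_bracket_on scale L br \<and>
     (\<forall>x\<in>L. \<forall>y\<in>L. br x y = - br y x) \<and>
     linear_self_map_on scale L \<alpha> \<and>
     (\<forall>x\<in>L. \<forall>y\<in>L. \<forall>z\<in>L.
        br (\<alpha> x) (br y z) + br (\<alpha> y) (br z x) + br (\<alpha> z) (br x y) = 0)"

text \<open>Endomorphisms with \<open>t \<mapsto> c t\<close> exist for every nonzero \<open>c\<close>.\<close>

lemma alg_endo_exists:
  fixes c :: complex
  assumes "c \<noteq> 0"
  shows "\<exists>\<phi>. alg_endo \<phi> \<and> \<phi> (tpow 1) = lscale c (tpow 1)"
proof -
  define h :: "laurent \<Rightarrow> laurent" where "h a = Poly_Mapping.mapp (\<lambda>k v. c powi k * v) a" for a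
  have lh: "Poly_Mapping.lookup (h a) k = c powi k * Poly_Mapping.lookup a k" for a k
    by (cases "k \<in> Poly_Mapping.keys a") (simp_all add: h_def mapp.rep_eq in_keys_iff)
  have add: "h (a + b) = h a + h b" for a b
    by (rule poly_mapping_eqI) (simp add: lh lookup_add algebra_simps)
  have sc: "Poly_Mapping.lookup (lscale s a) k = s * Poly_Mapping.lookup a k" for s a k
    by (auto simp: lscale_def Poly_Mapping.map.rep_eq when_def)
  have scale: "h (lscale s a) = lscale s (h a)" for s a
    by (rule poly_mapping_eqI) (simp add: lh sc)
  have sing: "h (Poly_Mapping.single k v) = Poly_Mapping.single k (c powi k * v)" for k v
    by (rule poly_mapping_eqI) (simp add: lh lookup_single when_def)
  have zero: "h 0 = 0"
    by (rule poly_mapping_eqI) (simp add: lh)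
  have expand: "a = (\<Sum>k\<in>Poly_Mapping.keys a. Poly_Mapping.single k (Poly_Mapping.lookup a k))"
    for a :: laurent
    by (rule poly_mapping_eqI) (simp add: lookup_sum lookup_single when_def in_keys_iff)
  have hsum: "h (sum f S) = (\<Sum>i\<in>S. h (f i))" for f :: "'i \<Rightarrow> laurent" and S
    by (induction S rule: infinite_finite_induct) (simp_all add: add zero)
  have hprod: "h (Poly_Mapping.single k v * Poly_Mapping.single l w) =
      h (Poly_Mapping.single k v) * h (Poly_Mapping.single l w)" for k v l w
    using assms by (simp add: sing mult_single power_int_add mult_ac)
  have mult: "h (a * b) = h a * h b" for a b
  proof -
    let ?s = "\<lambda>a. \<Sum>k\<in>Poly_Mapping.keys a. Poly_Mapping.single k (Poly_Mapping.lookup a k)"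
    have "h (?s a * ?s b) = h (?s a) * h (?s b)"
      by (simp only: sum_product hsum hprod)
    then show ?thesis
      by (simp only: expand[symmetric])
  qed
  have "Vector_Spaces.linear lscale lscale h"
    by unfold_locales (simp_all add: add scale)
  moreover have "h 1 = 1"
    by (metis sing single_one power_int_0_right mult_1)
  moreover have "h (tpow 1) = lscale c (tpow 1)"
    by (rule poly_mapping_eqI) (simp add: lh sc tpow_def lookup_single when_def)
  ultimately show ?thesis
    unfolding alg_endo_def using mult by blast
qed

end

theory Submission
  imports Defs
begin

text \<open>
  Since \<open>D(t) = t\<close> and \<open>t\<close> is a unit, \<open>a \<mapsto> a \<cdot> D\<close> is injective and identifies \<open>A\<close> with \<open>W\<close>. Under
  this identification the bracket is \<open>(S(a) b - a S(b)) / (p - q)\<close> and the twist is \<open>1 + S\<close>,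
  where \<open>S = \<sigma>\<tau>\<^sup>-\<^sup>1\<close>. For these the Hom-Jacobi identity holds for every endomorphism \<open>S\<close> of a
  commutative algebra, because the cyclic sum cancels termwise.
\<close>

section \<open>Coefficients and the monomial basis of the Laurent polynomials\<close>

lemma lookup_lscale: "Poly_Mapping.lookup (lscale s a) k = s * Poly_Mapping.lookup a k"
  by (auto simp: lscale_def Poly_Mapping.map.rep_eq when_def)

lemma lscale_mult_left: "lscale s a * b = lscale s (a * b)"
  by (simp add: lscale_conv_mult mult.assoc)

lemma lscale_mult_right: "a * lscale s b = lscale s (a * b)"
  by (simp add: lscale_conv_mult mult_ac)

lemma tpow_0: "tpow 0 = 1"
  by (simp add: tpow_def)

lemma tpow_mult: "tpow n * tpow m = tpow (n + m)"
  by (simp add: tpow_def mult_single)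

lemma lookup_tpow: "Poly_Mapping.lookup (tpow n) k = (if n = k then 1 else 0)"
  by (simp add: tpow_def lookup_single when_def)

lemma inj_tpow: "inj tpow"
  by (rule injI) (metis lookup_tpow zero_neq_one)

text \<open>Monomials are units: multiply by \<open>tpow (- n)\<close>.\<close>

lemma tpow_mult_cancel: "a * tpow n = b * tpow n \<longleftrightarrow> a = b"
  by (metis add.right_inverse mult.assoc mult.right_neutral tpow_0 tpow_mult)

lemma span_tpow: "laurent.span (range tpow) = UNIV"
proof -
  have "a \<in> laurent.span (range tpow)" for a
  proof -
    have "a = (\<Sum>k\<in>Poly_Mapping.keys a. lscale (Poly_Mapping.lookup a k) (tpow k))"
      by (rule poly_mapping_eqI)
        (simp add: lookup_sum lookup_lscale lookup_tpow in_keys_iff if_distrib cong: if_cong)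
    also have "\<dots> \<in> laurent.span (range tpow)"
      by (intro laurent.span_sum laurent.span_scale laurent.span_base) simp
    finally show ?thesis .
  qed
  then show ?thesis by blast
qed

text \<open>The functional reading off the coefficient at \<open>n\<close> kills every other
  monomial, hence their span, but not \<open>tpow n\<close>.\<close>

lemma independent_tpow: "laurent.independent (range tpow)"
  unfolding laurent.dependent_def
proof clarify
  fix n
  assume "tpow n \<in> laurent.span (range tpow - {tpow n})"
  moreover have "laurent.subspace {a. Poly_Mapping.lookup a n = 0}"
    by (simp add: laurent.subspace_def lookup_add lookup_lscale)
  then have "laurent.span (range tpow - {tpow n}) \<subseteq> {a. Poly_Mapping.lookup a n = 0}"
    by (rule laurent.span_minimal[rotated]) (auto simp: lookup_tpow)
  ultimately show False
    by (auto simp: lookup_tpow)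
qed

section \<open>Algebra endomorphisms and the scalings of \<open>t\<close>\<close>

lemma
  assumes "alg_endo \<phi>"
  shows alg_endo_add: "\<phi> (a + b) = \<phi> a + \<phi> b"
    and alg_endo_diff: "\<phi> (a - b) = \<phi> a - \<phi> b"
    and alg_endo_minus: "\<phi> (- a) = - \<phi> a"
    and alg_endo_scale: "\<phi> (lscale s a) = lscale s (\<phi> a)"
    and alg_endo_one: "\<phi> 1 = 1"
    and alg_endo_mult: "\<phi> (a * b) = \<phi> a * \<phi> b"
proof -
  interpret Vector_Spaces.linear lscale lscale \<phi>
    using assms by (simp add: alg_endo_def)
  show "\<phi> (a + b) = \<phi> a + \<phi> b" "\<phi> (a - b) = \<phi> a - \<phi> b" "\<phi> (- a) = - \<phi> a"
    "\<phi> (lscale s a) = lscale s (\<phi> a)"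
    by (simp_all add: add diff neg scale)
  show "\<phi> 1 = 1" "\<phi> (a * b) = \<phi> a * \<phi> b"
    using assms by (simp_all add: alg_endo_def)
qed

text \<open>Once \<open>lscale_conv_mult\<close> has turned scaling into multiplication by a
  constant, identities involving endomorphisms become ring identities; this fact lets the
  endomorphism pass over those constants.\<close>

lemma alg_endo_single_0:
  assumes "alg_endo \<phi>"
  shows "\<phi> (Poly_Mapping.single 0 s) = Poly_Mapping.single 0 s"
  using alg_endo_scale[OF assms, of s 1] by (simp add: lscale_conv_mult alg_endo_one[OF assms])

lemma alg_endo_comp:
  assumes "alg_endo \<phi>" "alg_endo \<psi>"
  shows "alg_endo (\<phi> \<circ> \<psi>)"
  using assms
  by (auto simp: alg_endo_def intro: Vector_Spaces.linear_compose)

lemma alg_endo_inv: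
  assumes "alg_endo \<phi>" "bij \<phi>"
  shows "alg_endo (inv \<phi>)"
proof -
  have eq: "inv \<phi> b = a" if "\<phi> a = b" for a b
    using assms(2) that by (metis bij_inv_eq_iff)
  have f: "\<phi> (inv \<phi> a) = a" for a
    using assms(2) by (simp add: bij_is_surj surj_f_inv_f)
  have "Vector_Spaces.linear lscale lscale (inv \<phi>)"
    by unfold_locales
      (auto intro!: eq simp: alg_endo_add[OF assms(1)] alg_endo_scale[OF assms(1)] f)
  then show ?thesis
    unfolding alg_endo_def
    by (auto intro!: eq simp: alg_endo_one[OF assms(1)] alg_endo_mult[OF assms(1)] f)
qed

lemma alg_endo_tpow:
  assumes "alg_endo \<phi>" "\<phi> (tpow 1) = lscale c (tpow 1)" "c \<noteq> 0"
  shows "\<phi> (tpow n) = lscale (c powi n) (tpow n)"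
proof (induction n rule: int_induct[where k = 0])
  case base
  show ?case by (simp add: tpow_0 alg_endo_one[OF assms(1)])
next
  case (step1 i)
  have "\<phi> (tpow (i + 1)) = \<phi> (tpow i) * \<phi> (tpow 1)"
    by (simp add: tpow_mult flip: alg_endo_mult[OF assms(1)])
  then show ?case
    using assms(3)
    by (simp add: step1 assms(2) lscale_mult_left lscale_mult_right tpow_mult power_int_add mult.commute add.commute)
next
  case (step2 i)
  \<comment> \<open>Downward step: both sides are the image of \<open>t^i\<close>, written with a
    factor \<open>t\<close>. That unit is cancelled first, then the scalar \<open>c\<close>.\<close>
  have "lscale c (\<phi> (tpow (i - 1))) * tpow 1 = \<phi> (tpow (i - 1)) * \<phi> (tpow 1)"
    by (simp add: assms(2) lscale_mult_left lscale_mult_right)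
  also have "\<dots> = lscale (c powi i) (tpow (i - 1)) * tpow 1"
    by (simp add: step2 lscale_mult_left tpow_mult flip: alg_endo_mult[OF assms(1)])
  finally have "lscale c (\<phi> (tpow (i - 1))) = lscale (c powi i) (tpow (i - 1))"
    by (simp only: tpow_mult_cancel)
  then have "lscale (1 / c) (lscale c (\<phi> (tpow (i - 1)))) = lscale (1 / c) (lscale (c powi i) (tpow (i - 1)))"
    by simp
  then show ?case
    using assms(3) by (simp add: power_int_diff)
qed

text \<open>The elements satisfying the formula form a subspace containing all monomials. So the
  value at \<open>t\<close> determines the endomorphism, which acts diagonally.\<close>

lemma lookup_alg_endo:
  assumes "alg_endo \<phi>" "\<phi> (tpow 1) = lscale c (tpow 1)" "c \<noteq> 0"
  shows "Poly_Mapping.lookup (\<phi> a) k = c powi k * Poly_Mapping.lookup a k"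
proof -
  let ?V = "{a. \<forall>k. Poly_Mapping.lookup (\<phi> a) k = c powi k * Poly_Mapping.lookup a k}"
  have "\<phi> 0 = 0"
    using alg_endo_scale[OF assms(1), of 0 0] by simp
  then have "laurent.subspace ?V"
    by (simp add: laurent.subspace_def alg_endo_add[OF assms(1)] alg_endo_scale[OF assms(1)]
        lookup_add lookup_lscale algebra_simps)
  moreover have "range tpow \<subseteq> ?V"
    by (auto simp: alg_endo_tpow[OF assms] lookup_lscale lookup_tpow)
  ultimately have "laurent.span (range tpow) \<subseteq> ?V"
    by (intro laurent.span_minimal)
  then show ?thesis by (auto simp: span_tpow)
qed

lemma bij_alg_endo:
  assumes "alg_endo \<phi>" "\<phi> (tpow 1) = lscale c (tpow 1)" "c \<noteq> 0"
  shows "bij \<phi>"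
proof -
  \<comment> \<open>The inverse is the endomorphism with \<open>t\<close> mapped to
    \<open>inverse c\<close> times \<open>t\<close>: either composition multiplies the coefficient
    at \<open>k\<close> by \<open>c^k c^(-k) = 1\<close>.\<close>
  from assms(3) have c': "inverse c \<noteq> 0" by simp
  from alg_endo_exists[OF this] obtain \<psi>
    where \<psi>: "alg_endo \<psi>" "\<psi> (tpow 1) = lscale (inverse c) (tpow 1)" by blast
  have "\<phi> (\<psi> a) = a" "\<psi> (\<phi> a) = a" for a
    using assms(3)
    by (auto intro!: poly_mapping_eqI
        simp: lookup_alg_endo[OF assms] lookup_alg_endo[OF \<psi> c'] power_int_inverse)
  then show ?thesis
    by (intro o_bij[of \<psi>]) (auto simp: fun_eq_iff)
qed

lemma inv_alg_endo_tpow: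
  assumes "alg_endo \<phi>" "\<phi> (tpow 1) = lscale c (tpow 1)" "c \<noteq> 0"
  shows "inv \<phi> (tpow n) = lscale (c powi (- n)) (tpow n)"
proof (rule inv_f_eq)
  show "inj \<phi>" using bij_alg_endo[OF assms] by (rule bij_is_inj)
  show "\<phi> (lscale (c powi - n) (tpow n)) = tpow n"
    using assms(3)
    by (simp add: alg_endo_scale[OF assms(1)] alg_endo_tpow[OF assms] power_int_minus)
qed

text \<open>Insert the mixed term \<sigma>(a)\<tau>(b): \<tau>(a)\<tau>(b) - \<sigma>(a)\<sigma>(b)
  = (\<tau>(a) - \<sigma>(a))\<tau>(b) + \<sigma>(a)(\<tau>(b) - \<sigma>(b)).\<close>

lemma twisted_derivation_diff:
  assumes "alg_endo \<tau>" "alg_endo \<sigma>"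
  shows "twisted_derivation \<tau> \<sigma> (oscale c (\<tau> - \<sigma>))"
proof -
  have "Vector_Spaces.linear lscale lscale (oscale c (\<tau> - \<sigma>))"
    by unfold_locales
      (simp_all add: oscale_def alg_endo_add[OF assms(1)] alg_endo_add[OF assms(2)]
        alg_endo_scale[OF assms(1)] alg_endo_scale[OF assms(2)]
        laurent.scale_right_distrib laurent.scale_right_diff_distrib mult.commute)
  then show ?thesis
    by (simp add: twisted_derivation_def oscale_def alg_endo_mult[OF assms(1)]
        alg_endo_mult[OF assms(2)] lscale_conv_mult algebra_simps)
qed

section \<open>Linear maps and brackets determined by generators\<close>

lemma linear_self_maps_eq_on_span:
  assumes f: "linear_self_map_on oscale (oper.span B) f"
    and g: "linear_self_map_on oscale (oper.span B) g"
    and eq: "\<And>b. b \<in> B \<Longrightarrow> f b = g b"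
    and x: "x \<in> oper.span B"
  shows "f x = g x"
proof -
  \<comment> \<open>Preservation of zero is not a clause of \<open>linear_self_map_on\<close>; it
    comes from homogeneity at the scalar 0 and starts the span induction.\<close>
  have "f (oscale 0 0) = g (oscale 0 0)"
    using f g oper.span_zero[of B] unfolding linear_self_map_on_def
    by (metis oper.scale_zero_left)
  then have zero: "f 0 = g 0" by simp
  have "x \<in> oper.span B \<and> f x = g x"
    using x
  proof (induction rule: oper.span_induct_alt)
    case base
    then show ?case using zero oper.span_zero by blast
  next
    case (step c b y)
    have "oscale c b \<in> oper.span B"
      using step by (intro oper.span_scale oper.span_base)
    then show ?case
      using f g eq[OF step(1)] step oper.span_base[OF step(1)] oper.span_add
      unfolding linear_self_map_on_def by metis
  qed
  then show ?thesis ..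
qed

lemma bilinear_brackets_eq_on_span:
  assumes f: "bilinear_bracket_on oscale (oper.span B) f"
    and g: "bilinear_bracket_on oscale (oper.span B) g"
    and eq: "\<And>a b. a \<in> B \<Longrightarrow> b \<in> B \<Longrightarrow> f a b = g a b"
    and x: "x \<in> oper.span B" and y: "y \<in> oper.span B"
  shows "f x y = g x y"
proof (rule linear_self_maps_eq_on_span[where f = "\<lambda>x. f x y" and g = "\<lambda>x. g x y", OF _ _ _ x])
  show "linear_self_map_on oscale (oper.span B) (\<lambda>x. f x y)"
    "linear_self_map_on oscale (oper.span B) (\<lambda>x. g x y)"
    using f g y by (auto simp: bilinear_bracket_on_def)
next
  fix a assume a: "a \<in> B"
  show "f a y = g a y"
  proof (rule linear_self_maps_eq_on_span[OF _ _ _ y])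
    show "linear_self_map_on oscale (oper.span B) (f a)"
      "linear_self_map_on oscale (oper.span B) (g a)"
      using f g oper.span_base[OF a] by (auto simp: bilinear_bracket_on_def)
  qed (rule eq[OF a])
qed

section \<open>Operators that are left multiples of one operator\<close>

lemma lmul_add: "(a + b) \<cdot>\<^sub>A F = a \<cdot>\<^sub>A F + b \<cdot>\<^sub>A F"
  by (simp add: lmul_def fun_eq_iff distrib_right)

lemma lmul_minus: "(- a) \<cdot>\<^sub>A F = - (a \<cdot>\<^sub>A F)"
  by (simp add: lmul_def fun_eq_iff)

lemma lmul_scale: "lscale s a \<cdot>\<^sub>A F = oscale s (a \<cdot>\<^sub>A F)"
  by (simp add: lmul_def oscale_def fun_eq_iff lscale_mult_left)

lemma lmul_zero: "0 \<cdot>\<^sub>A F = 0"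
  by (simp add: lmul_def fun_eq_iff)

lemma linear_lmul: "Vector_Spaces.linear lscale oscale (\<lambda>a. a \<cdot>\<^sub>A F)"
  by unfold_locales (simp_all add: lmul_add lmul_scale)

lemma overline_map_lmul:
  assumes "inj (\<lambda>a. a \<cdot>\<^sub>A D)"
  shows "overline_map D \<beta> (a \<cdot>\<^sub>A D) = \<beta> a \<cdot>\<^sub>A D"
proof -
  have "(THE b. b \<cdot>\<^sub>A D = a \<cdot>\<^sub>A D) = a"
    using assms by (intro the_equality) (auto dest: injD)
  then show ?thesis by (simp add: overline_map_def)
qed

section \<open>The bracket on coefficients\<close>

text \<open>This is the Wronskian-type bracket \<open>\<Delta>(a) b - a \<Delta>(b)\<close> for
  \<open>\<Delta> = c (S - id)\<close>, since the terms \<open>a b\<close> cancel.\<close>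

definition twisted_bracket :: "complex \<Rightarrow> (laurent \<Rightarrow> laurent) \<Rightarrow> laurent \<Rightarrow> laurent \<Rightarrow> laurent" where
  "twisted_bracket c S a b = lscale c (S a * b - a * S b)"

lemma twisted_bracket_skew: "twisted_bracket c S a b = - twisted_bracket c S b a"
  by (simp add: twisted_bracket_def lscale_conv_mult algebra_simps)

lemma
  assumes "alg_endo S"
  shows twisted_bracket_add_left:
      "twisted_bracket c S (a + a') b = twisted_bracket c S a b + twisted_bracket c S a' b"
    and twisted_bracket_scale_left:
      "twisted_bracket c S (lscale s a) b = lscale s (twisted_bracket c S a b)"
    and twisted_bracket_add_right:
      "twisted_bracket c S b (a + a') = twisted_bracket c S b a + twisted_bracket c S b a'"
    and twisted_bracket_scale_right:
      "twisted_bracket c S b (lscale s a) = lscale s (twisted_bracket c S b a)"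
  by (simp_all add: twisted_bracket_def alg_endo_add[OF assms] alg_endo_mult[OF assms]
      alg_endo_single_0[OF assms] lscale_conv_mult algebra_simps)

text \<open>\<open>S\<close> fixes constants, so \<open>c^2\<close> factors out. Of the eight
  remaining products, these pairs have opposite signs and equal cyclic sums: \<open>Sx Sy z\<close>
  and \<open>Sx y Sz\<close>; \<open>SSx Sy z\<close> and \<open>x SSy Sz\<close>;
  \<open>SSx y Sz\<close> and \<open>x Sy SSz\<close>; \<open>Sx SSy Sz\<close> and
  \<open>Sx Sy SSz\<close>.\<close>

lemma twisted_bracket_hom_jacobi:
  assumes "alg_endo S"
  shows "twisted_bracket c S (x + S x) (twisted_bracket c S y z) +
    twisted_bracket c S (y + S y) (twisted_bracket c S z x) +
    twisted_bracket c S (z + S z) (twisted_bracket c S x y) = 0"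
  by (simp add: twisted_bracket_def alg_endo_add[OF assms] alg_endo_single_0[OF assms]
      alg_endo_diff[OF assms] alg_endo_mult[OF assms] lscale_conv_mult algebra_simps)

text \<open>
  With \<open>S = \<sigma>\<tau>\<^sup>-\<^sup>1\<close>, the second-order terms \<open>S(a) S(b) D\<tau>\<^sup>-\<^sup>1D\<close> of the two compositions cancel.
\<close>

lemma lmul_twisted_bracket:
  assumes \<tau>: "alg_endo \<tau>" "bij \<tau>" and \<sigma>: "alg_endo \<sigma>"
    and D: "D = oscale c (\<tau> - \<sigma>)" and S: "S = \<sigma> \<circ> inv \<tau>"
  shows "((S a \<cdot>\<^sub>A D) \<circ> inv \<tau> \<circ> (b \<cdot>\<^sub>A D)) - ((S b \<cdot>\<^sub>A D) \<circ> inv \<tau> \<circ> (a \<cdot>\<^sub>A D)) =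
    twisted_bracket c S a b \<cdot>\<^sub>A D"
proof
  fix x
  have inv: "\<tau> (inv \<tau> y) = y" for y
    using \<tau>(2) by (simp add: bij_is_surj surj_f_inv_f)
  \<comment> \<open>\<open>D\<close> after \<open>inv \<tau>\<close> equals
    \<open>c (id - S)\<close>, an (id, S)-derivation. It is applied below with \<open>u\<close> one
    of the two coefficients and \<open>y = D x\<close>.\<close>
  have prod: "D (inv \<tau> (u * y)) = lscale c (u - S u) * y + S u * D (inv \<tau> y)" for u y
    by (simp add: alg_endo_mult[OF alg_endo_inv[OF \<tau>]] alg_endo_mult[OF \<tau>(1)]
        alg_endo_mult[OF \<sigma>] D S oscale_def inv lscale_conv_mult algebra_simps)
  show "(((S a \<cdot>\<^sub>A D) \<circ> inv \<tau> \<circ> (b \<cdot>\<^sub>A D)) - ((S b \<cdot>\<^sub>A D) \<circ> inv \<tau> \<circ> (a \<cdot>\<^sub>A D))) x =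
      (twisted_bracket c S a b \<cdot>\<^sub>A D) x"
    by (simp add: lmul_def prod twisted_bracket_def lscale_conv_mult algebra_simps)
qed

section \<open>Transfer from coefficients to operators\<close>

text \<open>Evaluating at a monomial fixed by \<open>D\<close> recovers \<open>a\<close> up to a
  unit factor.\<close>

lemma inj_lmul:
  assumes "D (tpow n) = tpow n"
  shows "inj (\<lambda>a. a \<cdot>\<^sub>A D)"
proof (rule injI)
  fix a b
  assume "a \<cdot>\<^sub>A D = b \<cdot>\<^sub>A D"
  then have "a * D (tpow n) = b * D (tpow n)"
    by (metis lmul_def)
  then show "a = b"
    by (simp only: assms tpow_mult_cancel)
qed

text \<open>The sign is absorbed into the linear map sending \<open>a\<close> to
  \<open>(- a) \<cdot>\<^sub>A D\<close>, so the generators are the image of the monomial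
  basis.\<close>

lemma
  fixes D :: "laurent \<Rightarrow> laurent"
  shows span_lmul_tpow:
      "oper.span (range (\<lambda>n. - (tpow n \<cdot>\<^sub>A D))) = range (\<lambda>a. a \<cdot>\<^sub>A D)"
    and independent_lmul_tpow:
      "inj (\<lambda>a. a \<cdot>\<^sub>A D) \<Longrightarrow> oper.independent (range (\<lambda>n. - (tpow n \<cdot>\<^sub>A D)))"
proof -
  let ?f = "\<lambda>a. (- a) \<cdot>\<^sub>A D"
  interpret vector_space_pair lscale oscale ..
  have lin: "Vector_Spaces.linear lscale oscale ?f"
    using linear_compose_neg[OF linear_lmul[of D]] by (simp only: lmul_minus)
  have range: "range (\<lambda>n. - (tpow n \<cdot>\<^sub>A D)) = ?f ` range tpow"
    by (simp only: image_image lmul_minus)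
  show "oper.span (range (\<lambda>n. - (tpow n \<cdot>\<^sub>A D))) = range (\<lambda>a. a \<cdot>\<^sub>A D)"
    unfolding range linear_span_image[OF lin] span_tpow
    by (auto simp: image_iff) (metis minus_minus)+
  assume inj: "inj (\<lambda>a. a \<cdot>\<^sub>A D)"
  then have "inj ?f"
    by (metis (no_types, lifting) injI injD neg_equal_iff_equal)
  then show "oper.independent (range (\<lambda>n. - (tpow n \<cdot>\<^sub>A D)))"
    unfolding range
    by (intro linear_independent_injective_image[OF lin independent_tpow])
      (rule inj_on_subset, auto)
qed

lemma hom_lie_algebra_lmul:
  assumes S: "alg_endo S"
    and br: "\<And>a b. br (a \<cdot>\<^sub>A D) (b \<cdot>\<^sub>A D) = twisted_bracket c S a b \<cdot>\<^sub>A D"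
    and \<alpha>: "\<And>a. \<alpha> (a \<cdot>\<^sub>A D) = (a + S a) \<cdot>\<^sub>A D"
  shows "hom_lie_algebra oscale (range (\<lambda>a. a \<cdot>\<^sub>A D)) br \<alpha>"
proof -
  have "oper.subspace (range (\<lambda>a. a \<cdot>\<^sub>A D))"
    unfolding span_lmul_tpow[symmetric] by (rule oper.subspace_span)
  moreover have "bilinear_bracket_on oscale (range (\<lambda>a. a \<cdot>\<^sub>A D)) br"
    unfolding bilinear_bracket_on_def linear_self_map_on_def ball_simps
    by (simp del: plus_fun_apply add: br twisted_bracket_add_left[OF S] twisted_bracket_add_right[OF S]
        twisted_bracket_scale_left[OF S] twisted_bracket_scale_right[OF S]
        flip: lmul_add lmul_scale)
  moreover have "linear_self_map_on oscale (range (\<lambda>a. a \<cdot>\<^sub>A D)) \<alpha>"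
    unfolding linear_self_map_on_def ball_simps
    by (simp add: \<alpha> alg_endo_add[OF S] alg_endo_scale[OF S] laurent.scale_right_distrib add_ac
        flip: lmul_add lmul_scale)
  moreover have "br (a \<cdot>\<^sub>A D) (b \<cdot>\<^sub>A D) = - br (b \<cdot>\<^sub>A D) (a \<cdot>\<^sub>A D)" for a b
    unfolding br lmul_minus[symmetric] by (subst twisted_bracket_skew) (rule refl)
  moreover have "br (\<alpha> (x \<cdot>\<^sub>A D)) (br (y \<cdot>\<^sub>A D) (z \<cdot>\<^sub>A D)) +
      br (\<alpha> (y \<cdot>\<^sub>A D)) (br (z \<cdot>\<^sub>A D) (x \<cdot>\<^sub>A D)) +
      br (\<alpha> (z \<cdot>\<^sub>A D)) (br (x \<cdot>\<^sub>A D) (y \<cdot>\<^sub>A D)) = 0" for x y z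
    unfolding \<alpha> br lmul_add[symmetric] twisted_bracket_hom_jacobi[OF S] by (rule lmul_zero)
  ultimately show ?thesis
    unfolding hom_lie_algebra_def ball_simps using oper.vector_space_axioms by blast
qed

section \<open>The two-parameter Witt algebra and its generators\<close>

theorem theorem3p1:
  fixes p q :: complex
    and \<tau> \<sigma> D :: "laurent \<Rightarrow> laurent"
    and d :: "int \<Rightarrow> laurent \<Rightarrow> laurent"
    and W :: "(laurent \<Rightarrow> laurent) set"
    and \<alpha> :: "(laurent \<Rightarrow> laurent) \<Rightarrow> (laurent \<Rightarrow> laurent)"
  assumes "p \<noteq> 0" and "q \<noteq> 0" and "p \<noteq> q"
    and "alg_endo \<tau>" and "\<tau> (tpow 1) = lscale p (tpow 1)"
    and "alg_endo \<sigma>" and "\<sigma> (tpow 1) = lscale q (tpow 1)"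
    and D: "D = oscale (1 / (p - q)) (\<tau> - \<sigma>)"
    and d: "d = (\<lambda>n. - (tpow n \<cdot>\<^sub>A D))"
    and W: "W = oper.span (range d)"
    and \<alpha>: "\<alpha> = (\<lambda>w. w + overline_map D \<sigma> (overline_map D (inv \<tau>) w))"
  shows
    \<comment> \<open>\<open>\<tau>\<close> is invertible, \<open>D\<close> is a twisted derivation, the overline maps are well defined
        and the sum defining \<open>W\<close> is direct\<close>
    "bij \<tau> \<and> alg_endo (inv \<tau>) \<and> twisted_derivation \<tau> \<sigma> D \<and>
     (\<forall>\<beta> a. alg_endo \<beta> \<longrightarrow> overline_map D \<beta> (a \<cdot>\<^sub>A D) = \<beta> a \<cdot>\<^sub>A D) \<and>
     inj d \<and> oper.independent (range d) \<and>
     (\<forall>n. \<alpha> (d n) = oscale (1 + (q / p) powi n) (d n)) \<and>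
     (\<exists>br.
        \<comment> \<open>\<open>br\<close> is the unique bilinear bracket on \<open>W\<close> with the prescribed values on generators\<close>
        (\<forall>n m. br (d n) (d m) =
           oscale (q powi n * p powi (- n)) (d n \<circ> inv \<tau> \<circ> d m) -
           oscale (q powi m * p powi (- m)) (d m \<circ> inv \<tau> \<circ> d n)) \<and>
        (\<forall>br'. bilinear_bracket_on oscale W br' \<and>
           (\<forall>n m. br' (d n) (d m) =
              oscale (q powi n * p powi (- n)) (d n \<circ> inv \<tau> \<circ> d m) -
              oscale (q powi m * p powi (- m)) (d m \<circ> inv \<tau> \<circ> d n)) \<longrightarrow>
           (\<forall>x\<in>W. \<forall>y\<in>W. br' x y = br x y)) \<and>
        hom_lie_algebra oscale W br \<alpha> \<and>
        (\<forall>n m. br (d n) (d m) =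
           oscale (pq_number p q n / p powi n - pq_number p q m / p powi m) (d (n + m))) \<and>
        (\<forall>n m. br (d m) (d n) = - br (d n) (d m)) \<and>
        (\<forall>n m k.
           br (oscale (1 + (q / p) powi n) (d n)) (br (d m) (d k)) +
           br (oscale (1 + (q / p) powi m) (d m)) (br (d k) (d n)) +
           br (oscale (1 + (q / p) powi k) (d k)) (br (d n) (d m)) = 0))"
proof -
  define c where "c = 1 / (p - q)"
  define S where "S = \<sigma> \<circ> inv \<tau>"
  note \<tau> = assms(4,5,1) and \<sigma> = assms(6,7,2)
  have bij: "bij \<tau>"
    by (rule bij_alg_endo[OF \<tau>])
  have inv: "alg_endo (inv \<tau>)"
    using \<tau>(1) bij by (rule alg_endo_inv)
  have S: "alg_endo S"
    unfolding S_def using \<sigma>(1) inv by (rule alg_endo_comp)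
  have S_tpow: "S (tpow n) = lscale ((q / p) powi n) (tpow n)" for n
    by (simp add: S_def inv_alg_endo_tpow[OF \<tau>] alg_endo_scale[OF \<sigma>(1)] alg_endo_tpow[OF \<sigma>]
        power_int_minus power_int_divide_distrib field_simps)
  have D': "D = oscale c (\<tau> - \<sigma>)"
    by (simp only: D c_def)
  \<comment> \<open>\<open>D\<close> scales \<open>t^n\<close> by \<open>[n]\<close>, which vanishes
    when \<open>(q/p)^n = 1\<close>; but \<open>[1] = 1\<close> always, so \<open>t\<close> is a
    safe test element.\<close>
  have "D (tpow 1) = tpow 1"
    using assms(3) by (simp add: D oscale_def \<tau>(2) \<sigma>(2) flip: laurent.scale_left_diff_distrib)
  then have inj: "inj (\<lambda>a. a \<cdot>\<^sub>A D)"
    by (rule inj_lmul)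
  have d': "d n = (- tpow n) \<cdot>\<^sub>A D" for n
    by (simp only: d lmul_minus)
  have W': "W = range (\<lambda>a. a \<cdot>\<^sub>A D)"
    unfolding W d by (rule span_lmul_tpow)
  have \<alpha>': "\<alpha> (a \<cdot>\<^sub>A D) = (a + S a) \<cdot>\<^sub>A D" for a
    by (simp only: \<alpha> overline_map_lmul[OF inj] lmul_add S_def o_apply)
  have \<alpha>_d: "\<alpha> (d n) = oscale (1 + (q / p) powi n) (d n)" for n
    by (simp only: d' \<alpha>' alg_endo_minus[OF S] S_tpow flip: lmul_scale)
      (simp add: laurent.scale_left_distrib)
  \<comment> \<open>The bracket must be total on operators, so it is defined through this inverse of
    \<open>a \<mapsto> a \<cdot>\<^sub>A D\<close>; outside \<open>W\<close> the coefficient is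
    unspecified.\<close>
  define coeff where "coeff w = (THE a. a \<cdot>\<^sub>A D = w)" for w
  have coeff: "coeff (a \<cdot>\<^sub>A D) = a" for a
    unfolding coeff_def using inj by (intro the_equality) (auto dest: injD)
  define br where "br x y = twisted_bracket c S (coeff x) (coeff y) \<cdot>\<^sub>A D" for x y
  have br: "br (a \<cdot>\<^sub>A D) (b \<cdot>\<^sub>A D) = twisted_bracket c S a b \<cdot>\<^sub>A D" for a b
    by (simp only: br_def coeff)
  have hom_lie: "hom_lie_algebra oscale W br \<alpha>"
    unfolding W' using S br \<alpha>' by (rule hom_lie_algebra_lmul)
  have bilin: "bilinear_bracket_on oscale W br"
    using hom_lie by (simp add: hom_lie_algebra_def)
  have d_W: "d n \<in> W" for n
    by (simp add: W oper.span_base)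
  have gen: "br (d n) (d m) =
      oscale (q powi n * p powi (- n)) (d n \<circ> inv \<tau> \<circ> d m) -
      oscale (q powi m * p powi (- m)) (d m \<circ> inv \<tau> \<circ> d n)" for n m
  proof -
    \<comment> \<open>The prescribed scalar is the eigenvalue of \<open>S\<close> at
      \<open>t^n\<close>, so it turns the coefficient of \<open>d n\<close> into its image under
      \<open>S\<close>, as \<open>lmul_twisted_bracket\<close> requires. \<open>F\<close> stands for
      the rest of the composition.\<close>
    have "q powi n * p powi (- n) = (q / p) powi n" for n
      by (simp add: power_int_minus_divide power_int_divide_distrib)
    then have *: "oscale (q powi n * p powi (- n)) (d n \<circ> F) = (S (- tpow n) \<cdot>\<^sub>A D) \<circ> F" for n F
      by (simp add: fun_eq_iff oscale_def d' lmul_def alg_endo_minus[OF S] S_tpow lscale_mult_left)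
    show ?thesis
      unfolding comp_assoc * unfolding d' br
      by (simp only: lmul_twisted_bracket[OF \<tau>(1) bij \<sigma>(1) D' S_def, symmetric] comp_assoc)
  qed
  have comm: "br (d n) (d m) =
      oscale (pq_number p q n / p powi n - pq_number p q m / p powi m) (d (n + m))" for n m
  proof -
    \<comment> \<open>The signs of \<open>- tpow n\<close> and \<open>- tpow m\<close> cancel,
      leaving \<open>c ((q/p)^n - (q/p)^m) t^(n+m)\<close>. Rewriting this with
      \<open>- tpow (n + m)\<close> reverses the difference, and the 1s in the two factors
      cancel.\<close>
    have "pq_number p q n / p powi n = c * (1 - (q / p) powi n)" for n
      using \<tau>(3) by (simp add: pq_number_def c_def power_int_divide_distrib field_simps)
    then have "twisted_bracket c S (- tpow n) (- tpow m) =
        lscale (pq_number p q n / p powi n - pq_number p q m / p powi m) (- tpow (n + m))"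
      by (simp add: twisted_bracket_def alg_endo_minus[OF S] S_tpow lscale_mult_left
          lscale_mult_right tpow_mult right_diff_distrib
          flip: laurent.scale_left_diff_distrib laurent.scale_minus_left)
    then show ?thesis
      by (simp only: d' br lmul_scale)
  qed
  have skew_W: "\<forall>x\<in>W. \<forall>y\<in>W. br x y = - br y x"
    using hom_lie unfolding hom_lie_algebra_def by (elim conjE)
  have jacobi_W: "\<forall>x\<in>W. \<forall>y\<in>W. \<forall>z\<in>W.
      br (\<alpha> x) (br y z) + br (\<alpha> y) (br z x) + br (\<alpha> z) (br x y) = 0"
    using hom_lie unfolding hom_lie_algebra_def by (elim conjE)
  have skew: "br (d m) (d n) = - br (d n) (d m)" for n m
    by (rule skew_W[rule_format, OF d_W d_W])
  have jacobi: "br (oscale (1 + (q / p) powi n) (d n)) (br (d m) (d k)) +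
      br (oscale (1 + (q / p) powi m) (d m)) (br (d k) (d n)) +
      br (oscale (1 + (q / p) powi k) (d k)) (br (d n) (d m)) = 0" for n m k
    \<comment> \<open>The factors are the eigenvalues of \<alpha> on the generators, so this is the
      general identity evaluated there.\<close>
    unfolding \<alpha>_d[symmetric] by (rule jacobi_W[rule_format, OF d_W d_W d_W])
  have unique: "br' x y = br x y"
    if "bilinear_bracket_on oscale W br'" "\<And>n m. br' (d n) (d m) = br (d n) (d m)" "x \<in> W" "y \<in> W"
    for br' x y
  proof (rule bilinear_brackets_eq_on_span[OF that(1)[unfolded W] bilin[unfolded W]])
    show "br' a b = br a b" if "a \<in> range d" "b \<in> range d" for a b
      using that \<open>\<And>n m. br' (d n) (d m) = br (d n) (d m)\<close> by blast
    show "x \<in> oper.span (range d)" "y \<in> oper.span (range d)"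
      using that(3,4) by (simp_all only: W)
  qed
  have "inj d"
  proof (rule injI)
    fix n m
    assume "d n = d m"
    then have "- tpow n = - tpow m"
      using injD[OF inj, of "- tpow n" "- tpow m"] by (simp only: d')
    then show "n = m"
      by (simp add: inj_eq[OF inj_tpow])
  qed
  moreover have "oper.independent (range d)"
    unfolding d using inj by (rule independent_lmul_tpow)
  moreover have "twisted_derivation \<tau> \<sigma> D"
    unfolding D using \<tau>(1) \<sigma>(1) by (rule twisted_derivation_diff)
  ultimately show ?thesis
    using bij inv overline_map_lmul[OF inj] \<alpha>_d
    by (intro conjI allI impI exI[of _ br] gen hom_lie comm skew jacobi ballI)
      (assumption | elim conjE, rule unique, assumption, simp only: gen)+
qed

end
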